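(* Let $H$ be a Hadamard matrix having a closed quadruple $Q$ of rows. Then the matrix produced from $H$ by switching $Q$ is a Hadamard matrix.
   Context: A Hadamard matrix of size $n$ is an $n\times n$ matrix with entries $\pm1$ whose rows are mutually orthogonal. Write $h_i$ for the rows of $H$, $h_{ij}$ for its entries, $\circ$ for the entrywise product of vectors, and $j_n$ for the all-ones vector of length $n$. A set of four distinct rows $Q=\{i,j,k,\ell\}$ of $H$ is a closed quadruple if $h_i\circ h_j\circ h_k\circ h_\ell=\pm j_n$. Negating columns of $H$ so that $h_i\circ h_j\circ h_k=j_n$ (3-normalization on rows $i,j,k$), one partitions the columns $c$ into four fields $C_1,C_2,C_3,C_4$, each of size $n/4$, according to whether $(h_{ic},h_{jc},h_{kc})$ in the normalized matrix equals $(1,1,1)$, $(-1,-1,1)$, $(-1,1,-1)$ or $(1,-1,-1)$; the partition does not depend on which three rows of $Q$ are used. Switching the closed quadruple $Q$ means negating all entries $h_{rc}$ of $H$ with $r\in Q$ and $c\in C_m$, for some $m\in\{1,2,3,4\}$. *)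

theory Defs
  imports "Jordan_Normal_Form.Matrix"
begin

definition hadamard_matrix :: "nat \<Rightarrow> int mat \<Rightarrow> bool" where
  "hadamard_matrix n H \<longleftrightarrow>
     H \<in> carrier_mat n n \<and>
     (\<forall>i<n. \<forall>j<n. H $$ (i, j) = 1 \<or> H $$ (i, j) = -1) \<and>
     (\<forall>i<n. \<forall>j<n. i \<noteq> j \<longrightarrow> row H i \<bullet> row H j = 0)"

definition ones_vec :: "nat \<Rightarrow> int vec" where
  "ones_vec n = vec n (\<lambda>_. 1)"

definition entrywise_prod :: "int vec \<Rightarrow> int vec \<Rightarrow> int vec" (infixl "\<odot>\<^sub>v" 70) where
  "u \<odot>\<^sub>v v = vec (dim_vec u) (\<lambda>c. u $ c * v $ c)"

definition closed_quadruple :: "int mat \<Rightarrow> nat set \<Rightarrow> bool" where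
  "closed_quadruple H Q \<longleftrightarrow>
     (\<exists>i j k l. Q = {i, j, k, l} \<and> distinct [i, j, k, l] \<and> Q \<subseteq> {..<dim_row H} \<and>
        (row H i \<odot>\<^sub>v row H j \<odot>\<^sub>v row H k \<odot>\<^sub>v row H l = ones_vec (dim_col H) \<or>
         row H i \<odot>\<^sub>v row H j \<odot>\<^sub>v row H k \<odot>\<^sub>v row H l = - ones_vec (dim_col H)))"

text \<open>For a matrix with entries 1 and -1 there is exactly one set of columns whose negation
  makes the entrywise product of rows i, j, k all-ones: the columns where that product is -1.\<close>

definition normalize3 :: "int mat \<Rightarrow> nat \<Rightarrow> nat \<Rightarrow> nat \<Rightarrow> int mat" where
  "normalize3 H i j k = mat (dim_row H) (dim_col H) (\<lambda>(r, c).
     if (row H i \<odot>\<^sub>v row H j \<odot>\<^sub>v row H k) $ c = -1 then - H $$ (r, c) else H $$ (r, c))"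

text \<open>The patterns are listed from index 0, so the field with number m (from 1 to 4) uses
  entry m - 1.\<close>

definition field_patterns :: "(int \<times> int \<times> int) list" where
  "field_patterns = [(1, 1, 1), (-1, -1, 1), (-1, 1, -1), (1, -1, -1)]"

definition column_field :: "int mat \<Rightarrow> nat \<Rightarrow> nat \<Rightarrow> nat \<Rightarrow> nat \<Rightarrow> nat set" where
  "column_field H i j k m =
     (let N = normalize3 H i j k
      in {c. c < dim_col H \<and>
             (N $$ (i, c), N $$ (j, c), N $$ (k, c)) = field_patterns ! (m - 1)})"

definition switch_quadruple :: "int mat \<Rightarrow> nat set \<Rightarrow> nat set \<Rightarrow> int mat" where
  "switch_quadruple H Q C = mat (dim_row H) (dim_col H) (\<lambda>(r, c).
     if r \<in> Q \<and> c \<in> C then - H $$ (r, c) else H $$ (r, c))"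

end

theory Submission
  imports Defs
begin

text \<open>Let \<open>a, b, c, d\<close> be the rows of \<open>Q\<close>, so that \<open>a b c d = s\<close> is a constant sign, and
  let \<open>C\<close> be the field with pattern \<open>(p, q, r)\<close>. After 3-normalization the first three rows
  become \<open>bc, ac, ab\<close>, whose product is 1, so the indicator function of \<open>C\<close> is
  \<open>(1 + p bc + q ac + r ab) / 4\<close>. Multiplying any row of \<open>Q\<close> by this function gives a linear
  combination of the four rows of \<open>Q\<close>, for instance \<open>(a + p s d + q c + r b) / 4\<close> for the
  row \<open>a\<close>. Hence every switched row of \<open>Q\<close> stays in the span of the rows of \<open>Q\<close>, which is
  orthogonal to all other rows. Inner products between two rows of \<open>Q\<close>, and between two rows
  outside \<open>Q\<close>, do not change.\<close>

lemma scalar_prod_row_row: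
  assumes "A \<in> carrier_mat n n" "x < n" "y < n"
  shows "row A x \<bullet> row A y = (\<Sum>c<n. A $$ (x, c) * A $$ (y, c))"
  using assms by (auto simp: scalar_prod_def atLeast0LessThan intro!: sum.cong)

text \<open>A product over the set \<open>Q\<close> does not depend on how its rows are ordered, so
  it transfers from the witnesses in \<open>closed_quadruple\<close> to any other enumeration of
  \<open>Q\<close>.\<close>

lemma closed_quadruple_prod:
  assumes "closed_quadruple H Q"
  obtains s :: int where "s = 1 \<or> s = -1" "\<And>c. c < dim_col H \<Longrightarrow> (\<Prod>r\<in>Q. H $$ (r, c)) = s"
    "card Q = 4" "Q \<subseteq> {..<dim_row H}"
proof -
  obtain i j k l where Q: "Q = {i, j, k, l}" and d: "distinct [i, j, k, l]"
    and sub: "Q \<subseteq> {..<dim_row H}"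
    and prod: "row H i \<odot>\<^sub>v row H j \<odot>\<^sub>v row H k \<odot>\<^sub>v row H l = ones_vec (dim_col H) \<or>
      row H i \<odot>\<^sub>v row H j \<odot>\<^sub>v row H k \<odot>\<^sub>v row H l = - ones_vec (dim_col H)"
    using assms unfolding closed_quadruple_def by blast
  have entry: "(\<Prod>r\<in>Q. H $$ (r, c)) = (row H i \<odot>\<^sub>v row H j \<odot>\<^sub>v row H k \<odot>\<^sub>v row H l) $ c"
    if "c < dim_col H" for c
    using that d sub unfolding Q by (simp add: entrywise_prod_def mult.assoc)
  have card: "card Q = 4"
    using d unfolding Q by simp
  from prod show thesis
  proof
    assume "row H i \<odot>\<^sub>v row H j \<odot>\<^sub>v row H k \<odot>\<^sub>v row H l = ones_vec (dim_col H)"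
    then show thesis
      using that[of 1] entry card sub by (simp add: ones_vec_def)
  next
    assume "row H i \<odot>\<^sub>v row H j \<odot>\<^sub>v row H k \<odot>\<^sub>v row H l = - ones_vec (dim_col H)"
    then show thesis
      using that[of "-1"] entry card sub by (simp add: ones_vec_def)
  qed
qed

lemma card_4_remaining:
  assumes "card Q = 4" "{i, j, k} \<subseteq> Q" "distinct [i, j, k]"
  obtains l where "Q = {i, j, k, l}" "distinct [i, j, k, l]"
proof -
  have "card (Q - {i, j, k}) = 1"
    using assms by (subst card_Diff_subset) auto
  then obtain l where l: "Q - {i, j, k} = {l}"
    by (auto simp: card_1_singleton_iff)
  show thesis
    by (rule that[of l]) (use l assms in auto)
qed

text \<open>Normalization multiplies column \<open>c\<close> by the product of its entries in rows
  \<open>i\<close>, \<open>j\<close>, \<open>k\<close>. Entries square to 1, so each of these three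
  entries turns into the product of the other two.\<close>

lemma mem_column_field_iff:
  assumes "hadamard_matrix n H" "i < n" "j < n" "k < n" "c < n"
    and "field_patterns ! (m - 1) = (p, q, r)"
  shows "c \<in> column_field H i j k m \<longleftrightarrow>
    H $$ (j, c) * H $$ (k, c) = p \<and> H $$ (i, c) * H $$ (k, c) = q \<and> H $$ (i, c) * H $$ (j, c) = r"
proof -
  have dims: "dim_row H = n" "dim_col H = n"
    using assms(1) by (auto simp: hadamard_matrix_def)
  have sgn: "H $$ (x, c) = 1 \<or> H $$ (x, c) = -1" if "x < n" for x
    using assms that by (auto simp: hadamard_matrix_def)
  let ?N = "normalize3 H i j k"
  have "?N $$ (i, c) = H $$ (j, c) * H $$ (k, c)" "?N $$ (j, c) = H $$ (i, c) * H $$ (k, c)"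
    "?N $$ (k, c) = H $$ (i, c) * H $$ (j, c)"
    using dims assms(2-5) sgn[OF assms(2)] sgn[OF assms(3)] sgn[OF assms(4)]
    by (auto simp: normalize3_def entrywise_prod_def)
  then show ?thesis
    using dims assms(5,6) by (simp add: column_field_def Let_def)
qed

text \<open>The factor 2 keeps the identity in the integers: the sign is 1 minus twice the indicator
  of the field.\<close>

lemma field_sign:
  fixes a b c p q r :: int
  assumes "a \<in> {1, -1}" "b \<in> {1, -1}" "c \<in> {1, -1}" "(p, q, r) \<in> set field_patterns"
  shows "2 * (if b * c = p \<and> a * c = q \<and> a * b = r then -1 else 1) =
    1 - p * (b * c) - q * (a * c) - r * (a * b)"
  using assms by (auto simp: field_patterns_def)

text \<open>Squares cancel, and a product of three of the signs is \<open>s\<close> times the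
  fourth, so no products of rows remain on the right.\<close>

lemma quadruple_row_times_sign:
  fixes a b c d s p q r :: int
  assumes "a \<in> {1, -1}" "b \<in> {1, -1}" "c \<in> {1, -1}" "d \<in> {1, -1}" "a * b * c * d = s"
  defines "e \<equiv> 1 - p * (b * c) - q * (a * c) - r * (a * b)"
  shows "e * a = a - r * b - q * c - p * s * d"
    and "e * b = b - r * a - p * c - q * s * d"
    and "e * c = c - q * a - p * b - r * s * d"
    and "e * d = d - p * s * a - q * s * b - r * s * c"
  using assms by (auto simp: algebra_simps)

lemma sum_combination_eq_0:
  fixes f :: "nat \<Rightarrow> int"
  assumes "\<And>c. c < n \<Longrightarrow> f c = u c * t c" "\<And>c. c < n \<Longrightarrow> u c = \<alpha> * v c - \<beta> * w c - \<gamma> * x c - \<delta> * y c"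
    and "(\<Sum>c<n. v c * t c) = 0" "(\<Sum>c<n. w c * t c) = 0"
    and "(\<Sum>c<n. x c * t c) = 0" "(\<Sum>c<n. y c * t c) = 0"
  shows "(\<Sum>c<n. f c) = 0"
proof -
  have "(\<Sum>c<n. f c) = (\<Sum>c<n. \<alpha> * (v c * t c) - \<beta> * (w c * t c) - \<gamma> * (x c * t c) - \<delta> * (y c * t c))"
    using assms(1,2) by (intro sum.cong) (auto simp: algebra_simps)
  then show ?thesis
    using assms(3-) by (simp add: sum_subtractf flip: sum_distrib_left)
qed

theorem proposition3p2:
  fixes H :: "int mat" and n i j k m :: nat and Q :: "nat set"
  assumes "hadamard_matrix n H"
    and "closed_quadruple H Q"
    and "{i, j, k} \<subseteq> Q" and "distinct [i, j, k]"
    and "m \<in> {1, 2, 3, 4}"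
  shows "hadamard_matrix n (switch_quadruple H Q (column_field H i j k m))"
proof -
  define C where "C = column_field H i j k m"
  define S where "S = switch_quadruple H Q C"
  have H: "H \<in> carrier_mat n n" and dims: "dim_row H = n" "dim_col H = n"
    and sgn: "\<And>x c. x < n \<Longrightarrow> c < n \<Longrightarrow> H $$ (x, c) \<in> {1, -1}"
    and orth: "\<And>x y. x < n \<Longrightarrow> y < n \<Longrightarrow> x \<noteq> y \<Longrightarrow> (\<Sum>c<n. H $$ (x, c) * H $$ (y, c)) = 0"
    using assms(1) by (auto simp: hadamard_matrix_def simp flip: scalar_prod_row_row)
  obtain s where s: "s = 1 \<or> s = -1" "\<And>c. c < n \<Longrightarrow> (\<Prod>r\<in>Q. H $$ (r, c)) = s"
    and card: "card Q = 4" and sub: "Q \<subseteq> {..<n}"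
    using closed_quadruple_prod[OF assms(2)] dims by metis
  obtain l where Q: "Q = {i, j, k, l}" and dist: "distinct [i, j, k, l]"
    using card_4_remaining[OF card assms(3,4)] .
  have lt: "i < n" "j < n" "k < n" "l < n"
    using sub Q by auto
  have prod: "H $$ (i, c) * H $$ (j, c) * H $$ (k, c) * H $$ (l, c) = s" if "c < n" for c
    using s(2)[OF that] dist unfolding Q by (simp add: mult.assoc)
  obtain p q r where pat: "field_patterns ! (m - 1) = (p, q, r)"
    by (metis prod_cases3)
  have "m - 1 < length field_patterns"
    using assms(5) by (auto simp: field_patterns_def)
  then have pat_in: "(p, q, r) \<in> set field_patterns"
    using pat by (metis nth_mem)

  \<comment> \<open>Twice the sign by which switching multiplies column \<open>c\<close> within the
    rows of \<open>Q\<close>.\<close>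
  define e where "e c = 1 - p * (H $$ (j, c) * H $$ (k, c)) - q * (H $$ (i, c) * H $$ (k, c))
    - r * (H $$ (i, c) * H $$ (j, c))" for c
  have e: "2 * (if c \<in> C then -1 else 1) = e c" if "c < n" for c
    using field_sign[OF sgn sgn sgn pat_in] that lt
    unfolding C_def mem_column_field_iff[OF assms(1) lt(1-3) that pat] e_def by blast
  have S_entry: "S $$ (x, c) = (if x \<in> Q \<and> c \<in> C then - H $$ (x, c) else H $$ (x, c))"
    if "x < n" "c < n" for x c
    using that dims by (simp add: S_def switch_quadruple_def)
  have S: "S \<in> carrier_mat n n"
    using dims by (simp add: S_def switch_quadruple_def)

  have mixed: "(\<Sum>c<n. S $$ (x, c) * S $$ (t, c)) = 0" if "x \<in> Q" "t \<notin> Q" "t < n" for x t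
  proof -
    have x: "x < n"
      using that sub by auto
    have orth_t: "(\<Sum>c<n. H $$ (y, c) * H $$ (t, c)) = 0" if "y \<in> Q" for y
      using orth[of y t] that \<open>t \<notin> Q\<close> \<open>t < n\<close> sub by auto
    have orthQ: "(\<Sum>c<n. H $$ (i, c) * H $$ (t, c)) = 0" "(\<Sum>c<n. H $$ (j, c) * H $$ (t, c)) = 0"
      "(\<Sum>c<n. H $$ (k, c) * H $$ (t, c)) = 0" "(\<Sum>c<n. H $$ (l, c) * H $$ (t, c)) = 0"
      using orth_t Q by auto
    \<comment> \<open>The explicit factor 1 and the bracketing match the shape required by
      \<open>sum_combination_eq_0\<close>.\<close>
    have rows: "e c * H $$ (i, c) = 1 * H $$ (i, c) - r * H $$ (j, c) - q * H $$ (k, c) - (p * s) * H $$ (l, c)"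
      "e c * H $$ (j, c) = 1 * H $$ (j, c) - r * H $$ (i, c) - p * H $$ (k, c) - (q * s) * H $$ (l, c)"
      "e c * H $$ (k, c) = 1 * H $$ (k, c) - q * H $$ (i, c) - p * H $$ (j, c) - (r * s) * H $$ (l, c)"
      "e c * H $$ (l, c) = 1 * H $$ (l, c) - (p * s) * H $$ (i, c) - (q * s) * H $$ (j, c) - (r * s) * H $$ (k, c)"
      if "c < n" for c
      using quadruple_row_times_sign[OF sgn sgn sgn sgn prod] that lt unfolding e_def by simp_all
    have "(\<Sum>c<n. e c * H $$ (x, c) * H $$ (t, c)) = 0"
    proof -
      consider "x = i" | "x = j" | "x = k" | "x = l"
        using \<open>x \<in> Q\<close> Q by auto
      then show ?thesis
      proof cases
        case 1
        show ?thesis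
          unfolding 1 by (rule sum_combination_eq_0[OF refl rows(1) orthQ(1,2,3,4)])
      next
        case 2
        show ?thesis
          unfolding 2 by (rule sum_combination_eq_0[OF refl rows(2) orthQ(2,1,3,4)])
      next
        case 3
        show ?thesis
          unfolding 3 by (rule sum_combination_eq_0[OF refl rows(3) orthQ(3,1,2,4)])
      next
        case 4
        show ?thesis
          unfolding 4 by (rule sum_combination_eq_0[OF refl rows(4) orthQ(4,1,2,3)])
      qed
    qed
    \<comment> \<open>Row \<open>t\<close> lies outside \<open>Q\<close> and is unchanged, so the
      switching sign enters only once.\<close>
    moreover have "2 * (S $$ (x, c) * S $$ (t, c)) = e c * H $$ (x, c) * H $$ (t, c)" if "c < n" for c
      using e[OF that] S_entry[of x c] S_entry[of t c] \<open>x \<in> Q\<close> \<open>t \<notin> Q\<close> \<open>t < n\<close> x that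
      by (auto split: if_splits)
    ultimately have "2 * (\<Sum>c<n. S $$ (x, c) * S $$ (t, c)) = 0"
      by (simp add: sum_distrib_left)
    then show ?thesis
      by simp
  qed
  \<comment> \<open>In each column either both entries are negated or neither is.\<close>
  have same: "(\<Sum>c<n. S $$ (x, c) * S $$ (y, c)) = (\<Sum>c<n. H $$ (x, c) * H $$ (y, c))"
    if "x \<in> Q \<longleftrightarrow> y \<in> Q" "x < n" "y < n" for x y
    using that S_entry by (intro sum.cong) auto
  have "row S x \<bullet> row S y = 0" if "x < n" "y < n" "x \<noteq> y" for x y
    unfolding scalar_prod_row_row[OF S that(1,2)]
    using mixed[of x y] mixed[of y x] same[of x y] orth[of x y] that
    by (cases "x \<in> Q"; cases "y \<in> Q") (auto simp: mult.commute)
  moreover have "S $$ (x, c) = 1 \<or> S $$ (x, c) = -1" if "x < n" "c < n" for x c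
    using S_entry[OF that] sgn[OF that] by auto
  ultimately show ?thesis
    using S unfolding hadamard_matrix_def S_def C_def by blast
qed

end
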